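(* Let $M$ be an $n\times n$ complex matrix all of whose eigenvalues are real, and let $z\in\mathbb{C}^n$, $z\neq0$. Let $$F=\{[M^kz]\in\mathbb{CP}^{n-1}\mid k\ge0,\ M^kz\ne0\},\qquad\mathfrak{S}_\infty=\overline{F}\setminus F,$$ where $\overline F$ is the closure of $F$ in $\mathbb{CP}^{n-1}$. Then $\mathfrak{S}_\infty$ contains at most $2$ points.
   Context: $[x]\in\mathbb{CP}^{n-1}$ denotes the class of a nonzero vector $x\in\mathbb{C}^n$, and $\mathbb{CP}^{n-1}$ carries its usual topology. *)

theory Defs
  imports "HOL-Analysis.Analysis"
begin

definition eigenvalue :: "'a::field ^ 'n ^ 'n \<Rightarrow> 'a \<Rightarrow> bool" where
  "eigenvalue A c \<longleftrightarrow> (\<exists>v. v \<noteq> 0 \<and> A *v v = c *s v)"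

(* The overloaded power operator on vectors of vectors would be entrywise;
   this is the power with respect to the matrix product. *)
primrec matpow :: "'a::semiring_1 ^ 'n ^ 'n \<Rightarrow> nat \<Rightarrow> 'a ^ 'n ^ 'n" where
  "matpow A 0 = mat 1"
| "matpow A (Suc k) = A ** matpow A k"

definition proj_rel :: "complex ^ 'n \<Rightarrow> complex ^ 'n \<Rightarrow> bool" where
  "proj_rel x y \<longleftrightarrow> x \<noteq> 0 \<and> y \<noteq> 0 \<and> (\<exists>c. c \<noteq> 0 \<and> y = c *s x)"

lemma part_equivp_proj_rel: "part_equivp (proj_rel :: complex ^ 'n \<Rightarrow> complex ^ 'n \<Rightarrow> bool)"
proof (rule part_equivpI)
  have "proj_rel (1 :: complex ^ 'n) 1"
    unfolding proj_rel_def by (metis vector_smult_lid zero_neq_one)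
  then show "\<exists>x. proj_rel (x :: complex ^ 'n) x" ..
  show "symp (proj_rel :: complex ^ 'n \<Rightarrow> complex ^ 'n \<Rightarrow> bool)"
  proof (rule sympI)
    fix x y :: "complex ^ 'n"
    assume "proj_rel x y"
    then obtain c where c: "x \<noteq> 0" "y \<noteq> 0" "c \<noteq> 0" "y = c *s x"
      unfolding proj_rel_def by blast
    then have "x = inverse c *s y" by (simp add: vector_smult_assoc)
    then show "proj_rel y x"
      unfolding proj_rel_def using c nonzero_imp_inverse_nonzero by blast
  qed
  show "transp (proj_rel :: complex ^ 'n \<Rightarrow> complex ^ 'n \<Rightarrow> bool)"
  proof (rule transpI)
    fix x y z :: "complex ^ 'n"
    assume "proj_rel x y" "proj_rel y z"
    then obtain c d where "x \<noteq> 0" "z \<noteq> 0" "c \<noteq> 0" "d \<noteq> 0" "z = (d * c) *s x"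
      unfolding proj_rel_def by (auto simp: vector_smult_assoc)
    then show "proj_rel x z"
      unfolding proj_rel_def using no_zero_divisors by blast
  qed
qed

(* The complex projective space of dimension CARD('n) - 1.  The class map
   proj_class is meaningful on nonzero vectors only; proj_class 0 is an
   unspecified value. *)
quotient_type (overloaded) 'n cproj = "complex ^ ('n::finite)" / partial: proj_rel
  morphisms rep_cproj proj_class
  by (rule part_equivp_proj_rel)

(* The quotient topology induced by proj_class from the nonzero vectors; as
   these form an open set, openness in the subspace is plain openness. *)
instantiation cproj :: (finite) topological_space
begin

definition open_cproj :: "'a cproj set \<Rightarrow> bool" where
  "open_cproj U \<longleftrightarrow> open {x :: complex ^ 'a. x \<noteq> 0 \<and> proj_class x \<in> U}"

instance
proof
  have "{x :: complex ^ 'a. x \<noteq> 0 \<and> proj_class x \<in> UNIV} = - {0}" by auto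
  then show "open (UNIV :: 'a cproj set)"
    unfolding open_cproj_def by (simp add: open_Compl)
next
  fix S T :: "'a cproj set"
  assume "open S" "open T"
  moreover have "{x :: complex ^ 'a. x \<noteq> 0 \<and> proj_class x \<in> S \<inter> T} =
      {x. x \<noteq> 0 \<and> proj_class x \<in> S} \<inter> {x. x \<noteq> 0 \<and> proj_class x \<in> T}" by auto
  ultimately show "open (S \<inter> T)"
    unfolding open_cproj_def by (simp add: open_Int)
next
  fix K :: "'a cproj set set"
  assume "\<forall>S\<in>K. open S"
  moreover have "{x :: complex ^ 'a. x \<noteq> 0 \<and> proj_class x \<in> \<Union>K} =
      (\<Union>S\<in>K. {x. x \<noteq> 0 \<and> proj_class x \<in> S})" by auto
  ultimately show "open (\<Union>K)"
    unfolding open_cproj_def by (simp add: open_UN)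
qed

end

lemma proj_class_eq_iff:
  assumes "x \<noteq> 0" and "y \<noteq> 0"
  shows "proj_class x = proj_class y \<longleftrightarrow> (\<exists>c. c \<noteq> 0 \<and> y = c *s x)"
proof -
  have refl: "proj_rel v v" if "v \<noteq> 0" for v :: "complex ^ 'a"
    unfolding proj_rel_def using that by (metis vector_smult_lid zero_neq_one)
  show ?thesis
    using Quotient_rel[OF Quotient_cproj, of x y] refl[OF assms(1)] refl[OF assms(2)] assms
    by (simp add: proj_rel_def)
qed

lemma proj_class_surj:
  fixes p :: "'n::finite cproj"
  shows "\<exists>x. x \<noteq> 0 \<and> p = proj_class x"
proof -
  have "proj_rel (rep_cproj p) (rep_cproj p)"
    using Quotient_rep_reflp[OF Quotient_cproj] .
  moreover have "p = proj_class (rep_cproj p)"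
    by (rule Quotient_abs_rep[OF Quotient_cproj, symmetric])
  ultimately show ?thesis
    unfolding proj_rel_def by blast
qed

end

theory Submission
  imports Defs "HOL-Computational_Algebra.Fundamental_Theorem_Algebra"
begin

text \<open>
  The matrix \<open>M\<^sup>2\<close> has only nonnegative real eigenvalues, and \<open>F\<close> is the union of the
  projective orbits of \<open>z\<close> and \<open>M z\<close> under \<open>A = M\<^sup>2\<close>. Each such orbit is finite or converges,
  so each contributes at most one point to \<open>closure F - F\<close>.

  Convergence is shown without Jordan form: \<open>w\<close> is annihilated by a product of factors
  \<open>A - c\<close> with \<open>c \<ge> 0\<close> an eigenvalue, and these are removed one at a time. If the
  sequence \<open>u (k + 1) - c u k\<close> divided by suitable positive numbers has a nonzero limit, then so does
  \<open>u\<close>: for \<open>c > 0\<close> the differences of \<open>u k / c ^ k\<close> have an asymptotic direction, which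
  by a Stolz-Cesaro argument passes to the partial sums, or to the tails if the sums tend to \<open>0\<close>.
\<close>

section \<open>Sequences with an asymptotic direction\<close>

text \<open>Stolz-Cesaro averaging: the early terms contribute a fixed amount, which the divergent
  sum of weights swamps, and every later term is at most \<open>r/2\<close> times its
  weight.\<close>

lemma weighted_sum_divergent:
  fixes e :: "nat \<Rightarrow> 'a::real_normed_vector"
  assumes d: "\<And>k. 0 < d k" and "\<not> summable d" and e: "e \<longlonglongrightarrow> 0"
  shows "(\<lambda>k. (\<Sum>j<k. d j *\<^sub>R e j) /\<^sub>R (1 + (\<Sum>j<k. d j))) \<longlonglongrightarrow> 0"
proof (rule LIMSEQ_I)
  fix r :: real assume r: "0 < r"
  define B where "B k = (\<Sum>j<k. d j)" for k
  have B0: "0 \<le> B k" for k unfolding B_def by (simp add: d less_imp_le sum_nonneg)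
  obtain N where N: "\<And>j. j \<ge> N \<Longrightarrow> norm (e j) < r/2"
    using LIMSEQ_D[OF e, of "r/2"] r by auto
  define C where "C = (\<Sum>j<N. d j * norm (e j))"
  have C0: "0 \<le> C" unfolding C_def by (simp add: d less_imp_le sum_nonneg)
  \<comment> \<open>Once \<open>B k\<close> exceeds \<open>2 * C / r\<close>, the early part
    \<open>C\<close> is below \<open>B k * (r/2)\<close>, so both halves together stay below
    \<open>r * B k\<close>.\<close>
  have "\<exists>K. 2 * C / r < B K"
  proof (rule ccontr)
    assume "\<not> ?thesis"
    then have "\<And>k. sum d {..<k} \<le> 2 * C / r" unfolding B_def by (auto simp: not_less)
    then have "summable d" using d by (intro bounded_imp_summable[where B="2*C/r"])
      (auto simp: less_imp_le, metis lessThan_Suc_atMost)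
    then show False using assms(2) by blast
  qed
  then obtain K where K: "2 * C / r < B K" by blast
  have mono: "B K \<le> B k" if "K \<le> k" for k
    unfolding B_def using that d by (intro sum_mono2) (auto simp: less_imp_le)
  have "norm ((\<Sum>j<k. d j *\<^sub>R e j) /\<^sub>R (1 + B k)) < r" if k: "k \<ge> max N K" for k
  proof -
    have "norm (\<Sum>j<k. d j *\<^sub>R e j) \<le> (\<Sum>j<k. d j * norm (e j))"
      by (rule order_trans[OF norm_sum]) (simp add: d less_imp_le)
    also have "\<dots> = C + (\<Sum>j\<in>{N..<k}. d j * norm (e j))"
    proof -
      have "{..<k} = {..<N} \<union> {N..<k}" using k by auto
      then show ?thesis unfolding C_def by (simp add: sum.union_disjoint ivl_disj_int)
    qed
    also have "(\<Sum>j\<in>{N..<k}. d j * norm (e j)) \<le> (\<Sum>j\<in>{N..<k}. d j * (r/2))"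
      using N d by (intro sum_mono mult_left_mono) (auto simp: less_imp_le)
    also have "\<dots> \<le> (\<Sum>j<k. d j * (r/2))"
      using d r by (intro sum_mono2) (auto simp: less_imp_le)
    also have "\<dots> = B k * (r/2)" unfolding B_def by (simp add: sum_distrib_right)
    finally have "norm (\<Sum>j<k. d j *\<^sub>R e j) \<le> C + B k * (r/2)" by simp
    also have "\<dots> < r * (1 + B k)"
    proof -
      have "2 * C / r < B k" using K mono k by force
      then have "2 * C < B k * r" using r by (simp add: field_simps)
      then show ?thesis using r by (simp add: algebra_simps)
    qed
    finally show ?thesis using B0[of k] by (simp add: divide_simps abs_if mult.commute)
  qed
  then show "\<exists>no. \<forall>k\<ge>no. norm ((\<Sum>j<k. d j *\<^sub>R e j) /\<^sub>R (1 + (\<Sum>j<k. d j)) - 0) < r"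
    unfolding B_def diff_0_right by blast
qed

text \<open>The 0/0 form of the averaging argument: a tail starting at \<open>k\<close> only
  involves indices from \<open>k\<close> on, where every \<open>e\<close> is already small.\<close>

lemma weighted_tail_summable:
  fixes e :: "nat \<Rightarrow> 'a::banach"
  assumes d: "\<And>k. 0 < d k" and sd: "summable d" and e: "e \<longlonglongrightarrow> 0"
  shows "(\<lambda>k. (\<Sum>j. d (j + k) *\<^sub>R e (j + k)) /\<^sub>R (\<Sum>j. d (j + k))) \<longlonglongrightarrow> 0"
proof (rule LIMSEQ_I)
  fix r :: real assume r: "0 < r"
  obtain N where N: "\<And>j. j \<ge> N \<Longrightarrow> norm (e j) < r/2"
    using LIMSEQ_D[OF e, of "r/2"] r by auto
  have "norm ((\<Sum>j. d (j + k) *\<^sub>R e (j + k)) /\<^sub>R (\<Sum>j. d (j + k))) < r" if k: "k \<ge> N" for k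
  proof -
    have s: "summable (\<lambda>j. d (j + k))" using sd by (rule summable_ignore_initial_segment)
    have T: "0 < (\<Sum>j. d (j + k))" using s d by (intro suminf_pos) auto
    have "norm (\<Sum>j. d (j + k) *\<^sub>R e (j + k)) \<le> (\<Sum>j. d (j + k) * (r/2))"
    proof (rule norm_suminf_le)
      show "norm (d (j + k) *\<^sub>R e (j + k)) \<le> d (j + k) * (r/2)" for j
        using N[of "j + k"] k d[of "j + k"] by (simp add: less_imp_le)
    qed (rule summable_mult2[OF s])
    also have "\<dots> = (\<Sum>j. d (j + k)) * (r/2)" by (rule suminf_mult2[OF s, symmetric])
    also have "\<dots> < (\<Sum>j. d (j + k)) * r" using T r by simp
    finally show ?thesis using T by (simp add: divide_simps mult.commute)
  qed
  then show "\<exists>no. \<forall>k\<ge>no. norm ((\<Sum>j. d (j + k) *\<^sub>R e (j + k)) /\<^sub>R (\<Sum>j. d (j + k)) - 0) < r"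
    by auto
qed

text \<open>A nonzero \<open>v\<close> makes the projective classes converge. The scales are
  positive reals because their partial sums and tails are then positive as well and can serve as new
  scales.\<close>

definition ray_convergent :: "(nat \<Rightarrow> 'a::real_normed_vector) \<Rightarrow> bool" where
  "ray_convergent u \<longleftrightarrow>
     (\<exists>b v. (\<forall>k. 0 < (b k :: real)) \<and> v \<noteq> 0 \<and> (\<lambda>k. u k /\<^sub>R b k) \<longlonglongrightarrow> v)"

lemma ray_convergentI:
  assumes "\<And>k. 0 < b k" and "v \<noteq> 0" and "(\<lambda>k. u k /\<^sub>R b k) \<longlonglongrightarrow> v"
  shows "ray_convergent u"
  unfolding ray_convergent_def using assms by blast

lemma ray_convergent_rescale:
  fixes u :: "nat \<Rightarrow> 'a::real_normed_vector"
  assumes "ray_convergent (\<lambda>k. u k /\<^sub>R a k)" and a: "\<And>k. 0 < a k"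
  shows "ray_convergent u"
proof -
  obtain b v where b: "\<And>k. 0 < (b k :: real)" "v \<noteq> 0" "(\<lambda>k. (u k /\<^sub>R a k) /\<^sub>R b k) \<longlonglongrightarrow> v"
    using assms(1) unfolding ray_convergent_def by blast
  show ?thesis
    by (rule ray_convergentI[of "\<lambda>k. b k * a k" v]) (use a b in simp_all)
qed

text \<open>If the scales \<open>d\<close> have a divergent sum, \<open>x\<close> grows like their
  partial sums in direction \<open>v\<close>. If they are summable, \<open>x\<close> converges; a
  nonzero limit is itself the direction, and for limit zero \<open>x k\<close> is minus the tail of
  its differences, with direction \<open>- v\<close>.\<close>

lemma ray_convergent_of_differences:
  fixes x :: "nat \<Rightarrow> 'a::banach"
  assumes "ray_convergent (\<lambda>k. x (Suc k) - x k)"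
  shows "(\<forall>\<^sub>F k in sequentially. x k = 0) \<or> ray_convergent x"
proof -
  obtain d v where d: "\<And>k. 0 < (d k :: real)" and v: "v \<noteq> 0"
    and lim: "(\<lambda>k. (x (Suc k) - x k) /\<^sub>R d k) \<longlonglongrightarrow> v"
    using assms unfolding ray_convergent_def by blast
  define y where "y k = (x (Suc k) - x k) /\<^sub>R d k" for k
  have diff: "x (Suc k) - x k = d k *\<^sub>R y k" for k
    unfolding y_def using d[of k] by simp
  have y: "y \<longlonglongrightarrow> v" using lim unfolding y_def .
  have tele: "x k = x 0 + (\<Sum>j<k. d j *\<^sub>R y j)" for k
    by (simp add: diff[symmetric] sum_lessThan_telescope)
  show ?thesis
  proof (cases "summable d")
    case False
    \<comment> \<open>The summand 1 keeps \<open>B 0\<close> positive and is the source of the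
      \<open>- v\<close> in the constant \<open>x 0 - v\<close> below.\<close>
    define B where "B k = 1 + (\<Sum>j<k. d j)" for k
    have B: "0 < B k" for k
      unfolding B_def by (intro add_pos_nonneg sum_nonneg) (auto simp: d less_imp_le)
    \<comment> \<open>The constant \<open>x 0 - v\<close> is absorbed into the term \<open>j = 0\<close>, so the averaging lemma covers it.\<close>
    define e where "e j = y j - v + (if j = 0 then (x 0 - v) /\<^sub>R d 0 else 0)" for j
    have "(\<lambda>j. if j = 0 then (x 0 - v) /\<^sub>R d 0 else 0) \<longlonglongrightarrow> 0"
      by (rule tendsto_eventually, rule eventually_sequentiallyI[of 1]) simp
    then have "e \<longlonglongrightarrow> 0 + 0"
      unfolding e_def using y by (intro tendsto_add LIM_zero)
    then have lim0: "(\<lambda>k. (\<Sum>j<k. d j *\<^sub>R e j) /\<^sub>R B k) \<longlonglongrightarrow> 0"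
      unfolding B_def using weighted_sum_divergent[OF d False] by simp
    \<comment> \<open>The sum contains the corrected term \<open>j = 0\<close> only for
      \<open>k > 0\<close>.\<close>
    have *: "x k - B k *\<^sub>R v = (\<Sum>j<k. d j *\<^sub>R e j)" if "k > 0" for k
    proof -
      have "d j *\<^sub>R e j = d j *\<^sub>R y j - d j *\<^sub>R v + (if j = 0 then x 0 - v else 0)" for j
        unfolding e_def using d[of 0] by (simp add: scaleR_add_right scaleR_diff_right)
      then have "(\<Sum>j<k. d j *\<^sub>R e j) = (\<Sum>j<k. d j *\<^sub>R y j) - (\<Sum>j<k. d j) *\<^sub>R v
          + (\<Sum>j<k. if j = 0 then x 0 - v else 0)"
        by (simp only: sum.distrib sum_subtractf scaleR_sum_left)
      also have "(\<Sum>j<k. if j = 0 then x 0 - v else 0) = x 0 - v"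
        using that by simp
      finally show ?thesis
        by (simp add: tele[of k] B_def scaleR_add_left)
    qed
    have "\<forall>\<^sub>F k in sequentially. (\<Sum>j<k. d j *\<^sub>R e j) /\<^sub>R B k = x k /\<^sub>R B k - v"
    proof (rule eventually_sequentiallyI[of 1])
      fix k :: nat assume "1 \<le> k"
      then show "(\<Sum>j<k. d j *\<^sub>R e j) /\<^sub>R B k = x k /\<^sub>R B k - v"
        using B[of k] by (simp add: *[symmetric] scaleR_diff_right)
    qed
    from Lim_transform_eventually[OF lim0 this] have "(\<lambda>k. x k /\<^sub>R B k) \<longlonglongrightarrow> v"
      by (rule LIM_zero_cancel)
    with B v show ?thesis by (blast intro: ray_convergentI)
  next
    case True
    obtain C where C: "\<And>k. norm (y k) \<le> C"
      using convergent_imp_Bseq[OF convergentI[OF y]] by (auto simp: Bseq_def)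
    have sy: "summable (\<lambda>j. d j *\<^sub>R y j)"
      by (rule summable_comparison_test'[OF summable_mult2[OF True, of C], of 0])
        (simp add: C d less_imp_le)
    define X where "X = x 0 + (\<Sum>j. d j *\<^sub>R y j)"
    have X: "x \<longlonglongrightarrow> X"
      unfolding X_def using tendsto_add[OF tendsto_const summable_LIMSEQ[OF sy], of "x 0"]
      by (simp flip: tele)
    show ?thesis
    proof (cases "X = 0")
      case False
      then show ?thesis using X ray_convergentI[of "\<lambda>_. 1" X x] by simp
    next
      case X0: True
      define T where "T k = (\<Sum>j. d (j + k))" for k
      have sd: "summable (\<lambda>j. d (j + k))" for k
        using True by (rule summable_ignore_initial_segment)
      have T: "0 < T k" for k
        unfolding T_def using sd d by (intro suminf_pos) auto
      have "x k /\<^sub>R T k = - v - (\<Sum>j. d (j + k) *\<^sub>R (y (j + k) - v)) /\<^sub>R T k" for k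
      proof -
        have syk: "summable (\<lambda>j. d (j + k) *\<^sub>R y (j + k))"
          using sy by (rule summable_ignore_initial_segment)
        have "x k = - (\<Sum>j. d (j + k) *\<^sub>R y (j + k))"
          using suminf_split_initial_segment[OF sy, of k] X0 tele[of k]
          unfolding X_def by (simp add: eq_neg_iff_add_eq_0 add.commute add.left_commute)
        also have "(\<Sum>j. d (j + k) *\<^sub>R y (j + k))
            = (\<Sum>j. d (j + k) *\<^sub>R (y (j + k) - v)) + T k *\<^sub>R v"
          unfolding T_def suminf_scaleR_left[OF sd]
          using suminf_diff[OF syk summable_scaleR_left[OF sd[of k], of v]]
          by (simp add: scaleR_diff_right algebra_simps)
        finally show ?thesis using T[of k] by (simp add: scaleR_add_right scaleR_diff_right)
      qed
      moreover have "(\<lambda>k. - v - (\<Sum>j. d (j + k) *\<^sub>R (y (j + k) - v)) /\<^sub>R T k) \<longlonglongrightarrow> - v - 0"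
        unfolding T_def
        by (intro tendsto_diff tendsto_const weighted_tail_summable d True LIM_zero y)
      ultimately have "(\<lambda>k. x k /\<^sub>R T k) \<longlonglongrightarrow> - v" by simp
      with T v show ?thesis by (intro disjI2 ray_convergentI[of T "- v"]) auto
    qed
  qed
qed

text \<open>Dividing by \<open>c ^ k\<close> turns the recurrence into plain differences;
  \<open>c > 0\<close> keeps the new scales positive. For \<open>c = 0\<close> the recurrence is
  merely a shift of the index.\<close>

lemma ray_convergent_of_first_order_recurrence:
  fixes u :: "nat \<Rightarrow> 'a::banach"
  assumes c: "0 \<le> c"
    and diff: "(\<forall>\<^sub>F k in sequentially. u (Suc k) - c *\<^sub>R u k = 0)
      \<or> ray_convergent (\<lambda>k. u (Suc k) - c *\<^sub>R u k)"
  shows "(\<forall>\<^sub>F k in sequentially. u k = 0) \<or> ray_convergent u"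
proof (cases "c = 0")
  case True
  from diff show ?thesis
  proof
    assume "\<forall>\<^sub>F k in sequentially. u (Suc k) - c *\<^sub>R u k = 0"
    with True show ?thesis using eventually_sequentially_Suc[of "\<lambda>k. u k = 0"] by simp
  next
    assume "ray_convergent (\<lambda>k. u (Suc k) - c *\<^sub>R u k)"
    then obtain b v where b: "\<And>k. 0 < (b k :: real)" and v: "v \<noteq> 0"
      and lim: "(\<lambda>k. u (Suc k) /\<^sub>R b k) \<longlonglongrightarrow> v"
      using True unfolding ray_convergent_def by auto
    have "ray_convergent u"
    proof (rule ray_convergentI[OF _ v])
      \<comment> \<open>The hypothesis scales \<open>u (Suc k)\<close> by \<open>b k\<close>, so the
        scale moves up by one index; its value at 0 only has to be positive.\<close>
      show "0 < (case k of 0 \<Rightarrow> 1 | Suc k \<Rightarrow> b k)" for k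
        using b by (simp split: nat.split)
      show "(\<lambda>k. u k /\<^sub>R (case k of 0 \<Rightarrow> 1 | Suc k \<Rightarrow> b k)) \<longlonglongrightarrow> v"
        by (rule LIMSEQ_imp_Suc) (use lim in simp)
    qed
    then show ?thesis ..
  qed
next
  case False
  with c have c: "0 < c" by simp
  define x where "x k = u k /\<^sub>R c ^ k" for k
  have dx: "x (Suc k) - x k = (u (Suc k) - c *\<^sub>R u k) /\<^sub>R c ^ Suc k" for k
    unfolding x_def using c by (simp add: scaleR_diff_right field_simps)
  have x0: "x k = 0 \<longleftrightarrow> u k = 0" for k unfolding x_def using c by simp
  have "(\<forall>\<^sub>F k in sequentially. x k = 0) \<or> ray_convergent x"
    using diff
  proof
    assume "\<forall>\<^sub>F k in sequentially. u (Suc k) - c *\<^sub>R u k = 0"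
    then obtain N where N: "\<And>k. k \<ge> N \<Longrightarrow> x (Suc k) - x k = 0"
      unfolding dx eventually_sequentially by auto
    \<comment> \<open>Vanishing differences freeze \<open>x\<close> from \<open>N\<close> on; its
      value there is either zero or the direction.\<close>
    have const: "x k = x N" if "k \<ge> N" for k
      using that by (induction rule: dec_induct) (use N in auto)
    have lim: "x \<longlonglongrightarrow> x N"
      by (rule tendsto_eventually, rule eventually_sequentiallyI[of N], rule const)
    show ?thesis
    proof (cases "x N = 0")
      case True
      then show ?thesis using const unfolding eventually_sequentially by metis
    next
      case False
      then show ?thesis using lim ray_convergentI[of "\<lambda>_. 1" "x N" x] by simp
    qed
  next
    assume "ray_convergent (\<lambda>k. u (Suc k) - c *\<^sub>R u k)"
    then obtain b v where b: "\<And>k. 0 < (b k :: real)" and v: "v \<noteq> 0"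
      and lim: "(\<lambda>k. (u (Suc k) - c *\<^sub>R u k) /\<^sub>R b k) \<longlonglongrightarrow> v"
      unfolding ray_convergent_def by blast
    have "ray_convergent (\<lambda>k. x (Suc k) - x k)"
    proof (rule ray_convergentI[OF _ v])
      show "0 < b k / c ^ Suc k" for k using b c by simp
      show "(\<lambda>k. (x (Suc k) - x k) /\<^sub>R (b k / c ^ Suc k)) \<longlonglongrightarrow> v"
        using lim c unfolding dx by (simp add: field_simps)
    qed
    then show ?thesis by (rule ray_convergent_of_differences)
  qed
  then show ?thesis
    using ray_convergent_rescale[where u = u and a = "\<lambda>k. c ^ k"] c
    unfolding x0 by (auto simp: x_def[abs_def])
qed

section \<open>Polynomials acting on vectors\<close>

text \<open>This is the vector p(A)w in Horner form, which suits induction over \<open>pCons\<close>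
  and avoids matrix powers.\<close>

definition poly_act :: "'a::field poly \<Rightarrow> 'a ^ 'n ^ 'n \<Rightarrow> 'a ^ 'n \<Rightarrow> 'a ^ 'n" where
  "poly_act p A w = fold_coeffs (\<lambda>a x. a *s w + A *v x) p 0"

lemma poly_act_0 [simp]: "poly_act 0 A w = 0"
  by (simp add: poly_act_def)

lemma poly_act_pCons [simp]: "poly_act (pCons a p) A w = a *s w + A *v poly_act p A w"
  by (cases "p = 0 \<and> a = 0") (auto simp: poly_act_def)

lemma poly_act_add: "poly_act (p + q) A w = poly_act p A w + poly_act q A w"
  by (induction p q rule: poly_induct2)
    (simp_all add: matrix_vector_right_distrib vector_sadd_rdistrib algebra_simps)

lemma poly_act_sum: "poly_act (\<Sum>i\<in>I. f i) A w = (\<Sum>i\<in>I. poly_act (f i) A w)"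
  by (induction I rule: infinite_finite_induct) (simp_all add: poly_act_add)

lemma poly_act_smult: "poly_act (smult c p) A w = c *s poly_act p A w"
  by (induction p) (simp_all add: vector_add_ldistrib vector_smult_assoc vector_scalar_commute)

lemma poly_act_monom: "poly_act (monom a i) A w = a *s (((*v) A) ^^ i) w"
  by (induction i) (simp_all add: monom_Suc monom_0 vector_scalar_commute)

lemma poly_act_linear_factor:
  "poly_act ([:- c, 1:] * q) A w = A *v poly_act q A w - c *s poly_act q A w"
proof -
  have "[:- c, 1:] * q = smult (- c) q + pCons 0 q" by simp
  then show ?thesis
    by (simp only: poly_act_add poly_act_smult poly_act_pCons) (simp add: vec.scale_minus_left)
qed

text \<open>Polynomials in \<open>A\<close> commute. Hence replacing \<open>w\<close> by
  \<open>A *v w - c *s w\<close> lets a factor be dropped from an annihilating polynomial.\<close>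

lemma poly_act_commute_linear_factor:
  "poly_act q A (A *v w - c *s w) = poly_act ([:- c, 1:] * q) A w"
  unfolding poly_act_linear_factor
  by (induction q)
    (simp_all add: matrix_vector_right_distrib matrix_vector_mult_diff_distrib vector_scalar_commute
      vec.scale_right_distrib vec.scale_right_diff_distrib vector_smult_assoc mult.commute)

text \<open>The iterates of \<open>w\<close> live in a finite-dimensional space, so they satisfy a
  linear relation, whose coefficients form the polynomial. Dependence is a property of sets, so a
  repeated iterate is treated separately.\<close>

lemma annihilating_poly_exists:
  fixes A :: "'a::field ^ 'n ^ 'n"
  shows "\<exists>p. p \<noteq> 0 \<and> poly_act p A w = 0"
proof (cases "inj (\<lambda>i. (((*v) A) ^^ i) w)")
  case True
  define f where "f i = (((*v) A) ^^ i) w" for i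
  have inj: "inj f" using True unfolding f_def .
  then have "infinite (range f)" using finite_imageD infinite_UNIV_nat by blast
  then have "vec.dependent (range f)" using vec.finiteI_independent by blast
  then obtain t u v where t: "finite t" "t \<subseteq> range f" "(\<Sum>v\<in>t. u v *s v) = 0" "v \<in> t" "u v \<noteq> 0"
    unfolding vec.dependent_explicit by blast
  define I where "I = f -` t"
  have tI: "t = f ` I" using t(2) unfolding I_def by auto
  have I: "finite I" unfolding I_def using t(1) inj by (rule finite_vimageI)
  define p where "p = (\<Sum>i\<in>I. monom (u (f i)) i)"
  have "poly_act p A w = (\<Sum>i\<in>I. u (f i) *s f i)"
    unfolding p_def f_def by (simp add: poly_act_sum poly_act_monom)
  also have "\<dots> = (\<Sum>v\<in>t. u v *s v)"
    unfolding tI using inj by (subst sum.reindex) (auto intro: inj_on_subset)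
  finally have "poly_act p A w = 0" using t(3) by simp
  moreover obtain i where "v = f i" "i \<in> I" using t(4) tI by blast
  then have "coeff p i \<noteq> 0"
    unfolding p_def using I t(5) by (simp add: coeff_sum)
  ultimately show ?thesis by (metis coeff_0)
next
  case False
  then obtain i j where ij: "i \<noteq> j" "(((*v) A) ^^ i) w = (((*v) A) ^^ j) w"
    unfolding inj_def by blast
  define p where "p = monom (1::'a) i + monom (- 1) j"
  have "poly_act p A w = 0"
    unfolding p_def poly_act_add poly_act_monom using ij(2) by simp
  moreover have "coeff p i \<noteq> 0" unfolding p_def using ij(1) by simp
  ultimately show ?thesis by (metis coeff_0)
qed

section \<open>Matrix powers and the spectrum of a square\<close>

lemma matpow_vector_mult: "matpow A k *v w = (((*v) A) ^^ k) w"
  by (induction k) (simp_all flip: matrix_vector_mul_assoc)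

text \<open>With \<open>s * s = c\<close>, the matrix M^2 - c factors as (M + s)(M - s). So an
  eigenvector \<open>v\<close> of the square is an eigenvector of \<open>M\<close> for
  \<open>s\<close>, or its image under M - s is one for \<open>- s\<close>; either way
  \<open>s\<close> is real.\<close>

lemma eigenvalue_square_imp_nonneg:
  fixes M :: "complex ^ 'n ^ 'n"
  assumes real: "\<And>c. eigenvalue M c \<Longrightarrow> c \<in> \<real>" and c: "eigenvalue (M ** M) c"
  shows "\<exists>r\<ge>0. c = of_real r"
proof -
  obtain v where v: "v \<noteq> 0" "M *v (M *v v) = c *s v"
    using c unfolding eigenvalue_def by (auto simp: matrix_vector_mul_assoc)
  define s where "s = csqrt c"
  have s: "s * s = c" unfolding s_def by (metis power2_csqrt power2_eq_square)
  define w where "w = M *v v - s *s v"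
  have w: "M *v w = (- s) *s w"
    unfolding w_def using v(2) s
    by (simp add: matrix_vector_mult_diff_distrib vector_scalar_commute
        vec.scale_right_diff_distrib vector_smult_assoc vec.scale_minus_left)
  have "eigenvalue M s \<or> eigenvalue M (- s)"
  proof (cases "w = 0")
    case True
    then show ?thesis unfolding eigenvalue_def w_def using v(1) by auto
  next
    case False
    then show ?thesis unfolding eigenvalue_def using w by blast
  qed
  then have "s \<in> \<real>" using real by fastforce
  then obtain r where "s = of_real r" by (rule Reals_cases)
  then have "c = of_real (r\<^sup>2)" using s by (simp add: power2_eq_square)
  then show ?thesis using zero_le_power2 by blast
qed

section \<open>The topology of projective space\<close>

text \<open>A set of nonzero vectors that is stable under nonzero scaling is the full preimage of
  its image, so the quotient topology sees its openness.\<close>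

lemma open_proj_class_image:
  fixes U :: "(complex ^ 'n::finite) set"
  assumes "open U" and "0 \<notin> U" and sat: "\<And>c a. c \<noteq> 0 \<Longrightarrow> a \<in> U \<Longrightarrow> c *s a \<in> U"
  shows "open (proj_class ` U)"
proof -
  have "{x. x \<noteq> 0 \<and> proj_class x \<in> proj_class ` U} = U"
  proof safe
    fix x a assume "x \<noteq> 0" "proj_class x = proj_class a" "a \<in> U"
    then obtain c where "c \<noteq> 0" "x = c *s a"
      using proj_class_eq_iff[of a x] assms(2) by metis
    then show "x \<in> U" using sat \<open>a \<in> U\<close> by simp
  qed (use assms(2) in auto)
  then show ?thesis unfolding open_cproj_def using assms(1) by simp
qed

text \<open>The unspecified class of 0 does no harm: \<open>f k\<close> eventually lies in an open
  preimage that excludes 0.\<close>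

lemma tendsto_proj_class:
  fixes v :: "complex ^ 'n::finite"
  assumes f: "(f \<longlongrightarrow> v) F" and v: "v \<noteq> 0"
  shows "((\<lambda>k. proj_class (f k)) \<longlongrightarrow> proj_class v) F"
proof (rule topological_tendstoI)
  fix S :: "'n cproj set" assume "open S" "proj_class v \<in> S"
  then have "\<forall>\<^sub>F k in F. f k \<in> {x. x \<noteq> 0 \<and> proj_class x \<in> S}"
    using topological_tendstoD[OF f, of "{x. x \<noteq> 0 \<and> proj_class x \<in> S}"] v
    unfolding open_cproj_def by auto
  then show "\<forall>\<^sub>F k in F. proj_class (f k) \<in> S" by (rule eventually_mono) auto
qed

text \<open>The two-by-two minors of the pair \<open>a\<close>, \<open>x\<close> all vanish exactly
  when the vectors are linearly dependent. Dividing by the l1 norm of \<open>a\<close> makes the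
  value depend only on the class of \<open>a\<close>.\<close>

definition minors_ratio :: "complex ^ 'n::finite \<Rightarrow> complex ^ 'n \<Rightarrow> real" where
  "minors_ratio x a = (\<Sum>i\<in>UNIV. \<Sum>j\<in>UNIV. norm (a $ i * x $ j - a $ j * x $ i)) / (\<Sum>i\<in>UNIV. norm (a $ i))"

lemma sum_norm_components_eq_0_iff:
  "(\<Sum>i\<in>UNIV. norm (a $ i)) = 0 \<longleftrightarrow> (a :: complex ^ 'n::finite) = 0"
  by (simp add: sum_nonneg_eq_0_iff vec_eq_iff)

lemma minors_ratio_scale:
  assumes "c \<noteq> 0"
  shows "minors_ratio x (c *s a) = minors_ratio x a"
proof -
  have "norm (c * a $ i * x $ j - c * a $ j * x $ i) = norm c * norm (a $ i * x $ j - a $ j * x $ i)" for i j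
    unfolding norm_mult[symmetric] by (simp add: algebra_simps)
  then show ?thesis
    using assms unfolding minors_ratio_def by (simp add: norm_mult flip: sum_distrib_left)
qed

lemma minors_ratio_self [simp]: "minors_ratio x x = 0"
  by (simp add: minors_ratio_def mult.commute)

lemma continuous_on_minors_ratio: "continuous_on (- {0}) (minors_ratio x)"
  unfolding minors_ratio_def
  by (intro continuous_intros ballI) (simp add: sum_norm_components_eq_0_iff)

lemma minors_ratio_pos:
  fixes x y :: "complex ^ 'n::finite"
  assumes "x \<noteq> 0" "y \<noteq> 0" "proj_class x \<noteq> proj_class y"
  shows "0 < minors_ratio x y"
proof (rule ccontr)
  assume "\<not> ?thesis"
  moreover have "0 \<le> minors_ratio x y"
    unfolding minors_ratio_def by (intro divide_nonneg_nonneg sum_nonneg) auto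
  ultimately have "minors_ratio x y = 0" by simp
  then have "(\<Sum>i\<in>UNIV. \<Sum>j\<in>UNIV. norm (y $ i * x $ j - y $ j * x $ i)) = 0"
    using assms(2) by (simp add: minors_ratio_def sum_norm_components_eq_0_iff)
  then have minors: "y $ i * x $ j = y $ j * x $ i" for i j
    by (simp add: sum_nonneg_eq_0_iff sum_nonneg)
  obtain j where j: "x $ j \<noteq> 0" using assms(1) by (auto simp: vec_eq_iff)
  \<comment> \<open>Vanishing minors make \<open>y\<close> proportional to \<open>x\<close>; the
    factor is read off at a coordinate where \<open>x\<close> is nonzero.\<close>
  have "y = (y $ j / x $ j) *s x"
    using minors[of _ j] j by (simp add: vec_eq_iff field_simps)
  moreover from this have "y $ j / x $ j \<noteq> 0" using assms(2) by auto
  ultimately show False using proj_class_eq_iff[OF assms(1,2)] assms(3) by blast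
qed

text \<open>The continuous, scale-invariant function \<open>minors_ratio x\<close> is 0 at
  \<open>x\<close> and \<open>r > 0\<close> at \<open>y\<close>, so its sets below and above
  \<open>r/2\<close> descend to disjoint neighbourhoods.\<close>

instance cproj :: (finite) t2_space
proof
  fix p q :: "'a cproj" assume "p \<noteq> q"
  then obtain x y where xy: "x \<noteq> 0" "y \<noteq> 0" "p = proj_class x" "q = proj_class y"
    "proj_class x \<noteq> proj_class y"
    using proj_class_surj[of p] proj_class_surj[of q] by auto
  define r where "r = minors_ratio x y"
  have r: "0 < r" unfolding r_def using xy by (intro minors_ratio_pos)
  define U where "U = {a \<in> - {0}. minors_ratio x a \<in> {..<r/2}}"
  define V where "V = {a \<in> - {0}. minors_ratio x a \<in> {r/2<..}}"
  have op: "open {a \<in> - {0}. minors_ratio x a \<in> S}" if "open S" for S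
    using continuous_open_preimage[OF continuous_on_minors_ratio _ that, of x]
    by (simp add: open_Compl vimage_def Int_def)
  have "open (proj_class ` U)" "open (proj_class ` V)"
    unfolding U_def V_def
    by (intro open_proj_class_image op; simp add: minors_ratio_scale)+
  moreover have "p \<in> proj_class ` U" "q \<in> proj_class ` V"
    unfolding U_def V_def xy(3,4) using xy(1,2) r by (auto simp: r_def)
  moreover have "proj_class ` U \<inter> proj_class ` V = {}"
  proof -
    have "proj_class a \<noteq> proj_class b" if "a \<in> U" "b \<in> V" for a b
    proof
      assume eq: "proj_class a = proj_class b"
      have "a \<noteq> 0" "b \<noteq> 0" using that unfolding U_def V_def by auto
      from proj_class_eq_iff[OF this] eq obtain c where "c \<noteq> 0" "b = c *s a" by auto
      then show False using that unfolding U_def V_def by (auto simp: minors_ratio_scale)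
    qed
    then show ?thesis by blast
  qed
  ultimately show "\<exists>U V. open U \<and> open V \<and> p \<in> U \<and> q \<in> V \<and> U \<inter> V = {}" by blast
qed

text \<open>In a Hausdorff space, the range of a convergent sequence has no limit point other than
  \<open>l\<close>.\<close>

lemma closure_range_subset_insert_limit:
  fixes f :: "nat \<Rightarrow> 'a::t2_space"
  assumes "f \<longlonglongrightarrow> l"
  shows "closure (range f) \<subseteq> insert l (range f)"
proof (rule closure_minimal)
  show "closed (insert l (range f))"
    using assms by (simp add: closed_limpt islimpt_insert sequence_unique_limpt)
qed auto

section \<open>Orbits\<close>

lemma of_real_smult_vec: "of_real r *s w = r *\<^sub>R (w :: complex ^ 'n)"
  unfolding vec_eq_iff by (simp add: scaleR_conv_of_real[where 'a = complex])

text \<open>Induction on the degree of an annihilating polynomial: split off a root \<open>c\<close>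
  with cofactor \<open>q\<close>. If \<open>q\<close> kills \<open>w\<close>, it takes over;
  otherwise q(A)w is an eigenvector for \<open>c\<close>, so \<open>c\<close> is real and
  nonnegative and the first-order recurrence applies.\<close>

lemma orbit_ray_convergent:
  fixes A :: "complex ^ 'n ^ 'n"
  assumes eig: "\<And>c. eigenvalue A c \<Longrightarrow> \<exists>r\<ge>0. c = of_real r"
  shows "(\<forall>\<^sub>F k in sequentially. (((*v) A) ^^ k) w = 0) \<or> ray_convergent (\<lambda>k. (((*v) A) ^^ k) w)"
proof -
  have main: "(\<forall>\<^sub>F k in sequentially. (((*v) A) ^^ k) w = 0) \<or> ray_convergent (\<lambda>k. (((*v) A) ^^ k) w)"
    if "p \<noteq> 0" "poly_act p A w = 0" for p w
    using that
  \<comment> \<open>The vector is generalised because the induction hypothesis is applied to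
    \<open>A *v w - c *s w\<close>.\<close>
  proof (induction "degree p" arbitrary: p w rule: less_induct)
    case less
    show ?case
    proof (cases "degree p = 0")
      case True
      then obtain a where "p = [:a:]" by (rule degree_eq_zeroE)
      with less.prems have w: "w = 0" by simp
      have "(((*v) A) ^^ k) w = 0" for k
        by (induction k) (simp_all add: w)
      then show ?thesis by simp
    next
      case False
      then obtain c where "poly p c = 0"
        using fundamental_theorem_of_algebra[of p] constant_degree[of p] by auto
      then obtain q where q: "p = [:- c, 1:] * q"
        unfolding poly_eq_0_iff_dvd by (elim dvdE)
      with less.prems(1) have q0: "q \<noteq> 0" by auto
      have deg: "degree q < degree p"
        unfolding q using q0 by (subst degree_mult_eq) auto
      show ?thesis
      proof (cases "poly_act q A w = 0")
        case True
        then show ?thesis using less.hyps[OF deg q0] by blast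
      next
        case False
        have "A *v poly_act q A w = c *s poly_act q A w"
          using less.prems(2) unfolding q poly_act_linear_factor by simp
        with False have "eigenvalue A c" unfolding eigenvalue_def by blast
        then obtain r where r: "0 \<le> r" "c = of_real r" using eig by blast
        have "poly_act q A (A *v w - c *s w) = 0"
          using less.prems(2) unfolding poly_act_commute_linear_factor q .
        note IH = less.hyps[OF deg q0 this]
        \<comment> \<open>The orbit of the new vector is the recurrence expression of the orbit of
          \<open>w\<close>.\<close>
        have diff: "(((*v) A) ^^ k) (A *v w - c *s w) = (((*v) A) ^^ Suc k) w - r *\<^sub>R (((*v) A) ^^ k) w" for k
        proof (induction k)
          case 0
          show ?case by (simp add: r(2) of_real_smult_vec)
        next
          case (Suc k)
          then show ?case
            by (simp add: matrix_vector_mult_diff_distrib vector_scalar_commute flip: of_real_smult_vec)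
        qed
        show ?thesis
          by (rule ray_convergent_of_first_order_recurrence[OF r(1) IH[unfolded diff]])
      qed
    qed
  qed
  then show ?thesis using annihilating_poly_exists[of A w] by blast
qed

lemma closure_projective_orbit:
  fixes A :: "complex ^ 'n ^ 'n" and w :: "complex ^ 'n"
  assumes eig: "\<And>c. eigenvalue A c \<Longrightarrow> \<exists>r\<ge>0. c = of_real r"
  defines "Orb \<equiv> {proj_class ((((*v) A) ^^ k) w) | k. (((*v) A) ^^ k) w \<noteq> 0}"
  shows "\<exists>l. closure Orb \<subseteq> insert l Orb"
proof -
  define u where "u k = (((*v) A) ^^ k) w" for k
  have Orb: "Orb = (\<lambda>k. proj_class (u k)) ` {k. u k \<noteq> 0}"
    unfolding Orb_def u_def by auto
  have zero: "u j = 0" if "u k = 0" "k \<le> j" for j k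
    using that(2,1) by (induction rule: dec_induct) (simp_all add: u_def)
  consider "\<forall>\<^sub>F k in sequentially. u k = 0" | "ray_convergent u"
    using orbit_ray_convergent[where A = A and w = w, OF eig] unfolding u_def[abs_def] by blast
  then show ?thesis
  proof cases
    case 1
    then obtain N where "\<And>k. k \<ge> N \<Longrightarrow> u k = 0" unfolding eventually_sequentially by blast
    then have "{k. u k \<noteq> 0} \<subseteq> {..<N}" by (auto simp: not_le[symmetric])
    then have "finite Orb" unfolding Orb by (intro finite_imageI) (rule finite_subset, auto)
    \<comment> \<open>A finite orbit is closed, so any \<open>l\<close> will do.\<close>
    then show ?thesis by (auto simp: finite_imp_closed)
  next
    case 2
    then obtain b v where b: "\<And>k. 0 < (b k :: real)" and v: "v \<noteq> 0"
      and lim: "(\<lambda>k. u k /\<^sub>R b k) \<longlonglongrightarrow> v"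
      unfolding ray_convergent_def by blast
    \<comment> \<open>One zero iterate makes all later ones zero, which would force the limit
      \<open>v\<close> to be zero. So \<open>Orb\<close> is the range of the whole sequence of
      classes.\<close>
    have nz: "u k \<noteq> 0" for k
    proof
      assume "u k = 0"
      then have "\<forall>\<^sub>F j in sequentially. u j /\<^sub>R b j = 0"
        using zero by (intro eventually_sequentiallyI[of k]) simp
      then have "(\<lambda>j. u j /\<^sub>R b j) \<longlonglongrightarrow> 0" by (rule tendsto_eventually)
      with lim v show False using LIMSEQ_unique by blast
    qed
    have "proj_class (u k /\<^sub>R b k) = proj_class (u k)" for k
    proof -
      have "u k = of_real (b k) *s (u k /\<^sub>R b k)"
        using b[of k] by (simp add: of_real_smult_vec)
      then show ?thesis
        using proj_class_eq_iff[of "u k /\<^sub>R b k" "u k"] nz[of k] b[of k]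
        by (metis less_irrefl of_real_eq_0_iff scaleR_eq_0_iff inverse_nonzero_iff_nonzero)
    qed
    then have "(\<lambda>k. proj_class (u k)) \<longlonglongrightarrow> proj_class v"
      using tendsto_proj_class[OF lim v] by simp
    then have "closure (range (\<lambda>k. proj_class (u k)))
        \<subseteq> insert (proj_class v) (range (\<lambda>k. proj_class (u k)))"
      by (rule closure_range_subset_insert_limit)
    then show ?thesis unfolding Orb using nz by auto
  qed
qed

theorem theoremA2:
  fixes M :: "complex ^ 'n ^ 'n" and z :: "complex ^ 'n"
    and F S_inf :: "'n cproj set"
  assumes "\<And>c. eigenvalue M c \<Longrightarrow> c \<in> \<real>"
    and "z \<noteq> 0"
    and "F = {proj_class (matpow M k *v z) | k. matpow M k *v z \<noteq> 0}"
    and "S_inf = closure F - F"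
  shows "finite S_inf \<and> card S_inf \<le> 2"
proof -
  \<comment> \<open>Even and odd powers are separated because eigenvalues of opposite sign can make
    the directions alternate.\<close>
  define Orb where "Orb w = {proj_class ((((*v) (M ** M)) ^^ k) w) | k. (((*v) (M ** M)) ^^ k) w \<noteq> 0}" for w
  have eig: "\<exists>r\<ge>0. c = of_real r" if "eigenvalue (M ** M) c" for c
    using eigenvalue_square_imp_nonneg[OF assms(1) that] .
  have orbit_even: "(((*v) (M ** M)) ^^ k) w = (((*v) M) ^^ (2 * k)) w" for k w
    by (induction k) (simp_all flip: matrix_vector_mul_assoc)
  have orbit_odd: "(((*v) (M ** M)) ^^ k) (M *v w) = (((*v) M) ^^ (Suc (2 * k))) w" for k w
    unfolding orbit_even by (simp add: funpow_swap1)
  have "F = Orb z \<union> Orb (M *v z)"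
  proof
    show "F \<subseteq> Orb z \<union> Orb (M *v z)"
    proof
      fix p assume "p \<in> F"
      then obtain k where k: "p = proj_class ((((*v) M) ^^ k) z)" "(((*v) M) ^^ k) z \<noteq> 0"
        unfolding assms(3) matpow_vector_mult by blast
      show "p \<in> Orb z \<union> Orb (M *v z)"
      proof (cases "even k")
        case True
        then obtain m where "k = 2 * m" by (elim evenE)
        with k have "p \<in> Orb z" unfolding Orb_def orbit_even by blast
        then show ?thesis ..
      next
        case False
        then obtain m where "k = Suc (2 * m)" by (elim oddE) simp
        with k have "p \<in> Orb (M *v z)" unfolding Orb_def orbit_odd by blast
        then show ?thesis ..
      qed
    qed
    have "Orb z \<subseteq> F"
      unfolding Orb_def orbit_even assms(3) matpow_vector_mult by blast
    moreover have "Orb (M *v z) \<subseteq> F"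
      unfolding Orb_def orbit_odd assms(3) matpow_vector_mult by blast
    ultimately show "Orb z \<union> Orb (M *v z) \<subseteq> F" by simp
  qed
  moreover have "\<exists>l. closure (Orb w) \<subseteq> insert l (Orb w)" for w
    unfolding Orb_def by (rule closure_projective_orbit[where A = "M ** M" and w = w, OF eig])
  then obtain l l' where "closure (Orb z) \<subseteq> insert l (Orb z)"
    "closure (Orb (M *v z)) \<subseteq> insert l' (Orb (M *v z))"
    by meson
  \<comment> \<open>Closure commutes with the finite union, so every point of the closure outside
    \<open>F\<close> is \<open>l\<close> or \<open>l'\<close>.\<close>
  ultimately have sub: "S_inf \<subseteq> {l, l'}"
    unfolding assms(4) by (auto simp: closure_Un)
  then have "card S_inf \<le> card {l, l'}" by (intro card_mono) auto
  also have "\<dots> \<le> 2" by (simp add: card_insert_if)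
  finally show ?thesis using sub finite_subset by blast
qed

end
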